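(* Let $X$ be a half-synchronized system and let $\varphi: X\rightarrow Y$ be a factor map onto a subshift $Y$. Then $\varphi$ is both right-closing a.e. and 1-1 a.e. if and only if $\varphi$ has a decoder block.
   Context: A subshift (shift space) $X$ over a finite non-empty alphabet $\mathcal A$ is a closed shift-invariant subset of $\mathcal A^{\mathbb Z}$ (with the shift map $\sigma(x)_i=x_{i+1}$). $\mathcal B_n(X)$ is the set of blocks of length $n$ occurring in points of $X$, and $\mathcal B(X)=\bigcup_{n\ge 0}\mathcal B_n(X)$ is the language of $X$; $|u|$ is the length of a block $u$, and $x_{[i,j]}=x_i x_{i+1}\cdots x_j$. $X$ is transitive (irreducible) if for all $u,v\in\mathcal B(X)$ there is a block $w$ with $uwv\in\mathcal B(X)$. A factor map $\varphi:X\to Y$ is an onto sliding block code, i.e. a surjective map for which there are integers $m,n$ with $-m\le n$ and a block map $\Phi:\mathcal B_{m+n+1}(X)\to\mathcal D$ ($\mathcal D$ the alphabet of $Y$) such that $\varphi(x)_i=\Phi(x_{[i-m,i+n]})$ for all $i\in\mathbb Z$. Follower sets: $X^+=\{(x_i)_{i\ge 0}: x\in X\}$. For a left-infinite ray $x_-$ of $X$ (the left half of a point of $X$, such as $x_{(-\infty,0]}$, up to re-indexing), $\omega_+(x_-)$ is the set of right-infinite rays $x_+\in X^+$ such that the concatenation $x_-x_+$ is a point of $X$. For a block $m\in\mathcal B(X)$, $\omega_+(m)$ is the set of right-infinite rays $x_+\in X^+$ such that $m x_+$ occurs in a point of $X$ (that is, some point of $X$ has a right ray equal to $mx_+$). A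 point $x\in X$ is left-transitive if every block of $\mathcal B(X)$ appears in $x$ infinitely often to the left; it is doubly transitive if every block of $\mathcal B(X)$ appears in $x$ infinitely often to the left and to the right. Half-synchronized: a transitive subshift $X$ is half-synchronized (a half-synchronized system) if there is a block $m\in\mathcal B(X)$ and a left-transitive point $x\in X$ such that $x_{[-|m|+1,0]}=m$ and $\omega_+(x_{(-\infty,0]})=\omega_+(m)$. A factor map $\varphi:X\to Y$ is 1-1 a.e. if every doubly transitive point of $Y$ has exactly one preimage under $\varphi$. It is right-closing a.e. (almost everywhere) if there is $n\in\mathbb N$ such that for any two left-transitive points $x,y\in X$ with $x_{(-\infty,0]}=y_{(-\infty,0]}$ and $\varphi(x)_{(-\infty,n]}=\varphi(y)_{(-\infty,n]}$, it holds that $x_1=y_1$. A block $w\in\mathcal B(Y)$ is a decoder block for $\varphi$ if there is $k\in\mathbb N$ (the anticipation of $w$) such that for all $n\in\mathbb N$ and all points $x,y\in X$ with $\varphi(x)_{[-|w|+1,0]}=\varphi(y)_{[-|w|+1,0]}=w$ and $\varphi(x)_{[1,n+k]}=\varphi(y)_{[1,n+k]}$, it holds that $x_{[1,n]}=y_{[1,n]}$. *)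

theory Defs
  imports "HOL-Analysis.Analysis" "HOL-Library.Omega_Words_Fun"
begin

section \<open>Subshifts and their languages\<close>

type_synonym 'a biseq = "int \<Rightarrow> 'a"

definition shift_map :: "'a biseq \<Rightarrow> 'a biseq" where
  "shift_map x = (\<lambda>i. x (i + 1))"

text \<open>The topological space below is the full shift over the alphabet \<open>A\<close>: the set of
  all bi-infinite sequences with values in \<open>A\<close>, with the product of the discrete topologies.
  Shift-invariance is the equality \<open>\<sigma>(X) = X\<close>, as usual for subshifts.\<close>

definition subshift :: "'a set \<Rightarrow> 'a biseq set \<Rightarrow> bool" where
  "subshift A X \<longleftrightarrow>
     finite A \<and> A \<noteq> {} \<and>
     closedin (product_topology (\<lambda>_. discrete_topology A) UNIV) X \<and>
     shift_map ` X = X"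

text \<open>\<open>block x i j\<close> is \<open>x\<^sub>i x\<^sub>i\<^sub>+\<^sub>1 \<dots> x\<^sub>j\<close>; it is empty if \<open>j < i\<close>.\<close>

definition block :: "'a biseq \<Rightarrow> int \<Rightarrow> int \<Rightarrow> 'a list" where
  "block x i j = map x [i..j]"

definition blocks :: "nat \<Rightarrow> 'a biseq set \<Rightarrow> 'a list set" where
  "blocks n X = {block x i (i + int n - 1) | x i. x \<in> X}"

definition language :: "'a biseq set \<Rightarrow> 'a list set" where
  "language X = (\<Union>n. blocks n X)"

definition transitive :: "'a biseq set \<Rightarrow> bool" where
  "transitive X \<longleftrightarrow> (\<forall>u\<in>language X. \<forall>v\<in>language X. \<exists>w. u @ w @ v \<in> language X)"

definition left_transitive :: "'a biseq set \<Rightarrow> 'a biseq \<Rightarrow> bool" where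
  "left_transitive X x \<longleftrightarrow>
     x \<in> X \<and> (\<forall>u\<in>language X. infinite {i. i \<le> 0 \<and> block x i (i + int (length u) - 1) = u})"

definition doubly_transitive :: "'a biseq set \<Rightarrow> 'a biseq \<Rightarrow> bool" where
  "doubly_transitive X x \<longleftrightarrow>
     left_transitive X x \<and>
     (\<forall>u\<in>language X. infinite {i. i \<ge> 0 \<and> block x i (i + int (length u) - 1) = u})"

section \<open>Follower sets and half-synchronized systems\<close>

text \<open>Right rays are indexed by \<open>0, 1, 2, \<dots>\<close> from left to right.  Left rays are indexed by
  \<open>0, 1, 2, \<dots>\<close> from right to left, so that entry \<open>k\<close> of \<open>left_ray x\<close> is \<open>x\<^sub>-\<^sub>k\<close>.\<close>

definition right_ray :: "'a biseq \<Rightarrow> 'a word" where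
  "right_ray x = (\<lambda>k. x (int k))"

definition left_ray :: "'a biseq \<Rightarrow> 'a word" where
  "left_ray x = (\<lambda>k. x (- int k))"

text \<open>The concatenation of a left and a right ray, with the left ray at coordinates \<open>\<le> 0\<close>.\<close>

definition join_rays :: "'a word \<Rightarrow> 'a word \<Rightarrow> 'a biseq" where
  "join_rays l r = (\<lambda>i. if i \<le> 0 then l (nat (- i)) else r (nat (i - 1)))"

definition right_rays :: "'a biseq set \<Rightarrow> 'a word set" where
  "right_rays X = right_ray ` X"

definition follower_ray :: "'a biseq set \<Rightarrow> 'a word \<Rightarrow> 'a word set" where
  "follower_ray X l = {r \<in> right_rays X. join_rays l r \<in> X}"

definition follower_block :: "'a biseq set \<Rightarrow> 'a list \<Rightarrow> 'a word set" where
  "follower_block X m =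
     {r \<in> right_rays X. \<exists>x\<in>X. \<exists>i. (\<lambda>k. x (i + int k)) = m \<frown> r}"

definition half_synchronized :: "'a biseq set \<Rightarrow> bool" where
  "half_synchronized X \<longleftrightarrow>
     transitive X \<and>
     (\<exists>m\<in>language X. \<exists>x\<in>X. left_transitive X x \<and>
        block x (- int (length m) + 1) 0 = m \<and>
        follower_ray X (left_ray x) = follower_block X m)"

section \<open>Factor maps\<close>

text \<open>Only the restriction of \<open>\<phi>\<close> to \<open>X\<close> and the values of the block map \<open>\<Phi>\<close> on blocks of
  \<open>X\<close> are relevant; surjectivity onto \<open>Y\<close> puts the latter in the alphabet of \<open>Y\<close>.\<close>

definition factor_map ::
    "'a biseq set \<Rightarrow> 'b biseq set \<Rightarrow> ('a biseq \<Rightarrow> 'b biseq) \<Rightarrow> bool" where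
  "factor_map X Y \<phi> \<longleftrightarrow>
     \<phi> ` X = Y \<and>
     (\<exists>m n :: int. - m \<le> n \<and>
        (\<exists>\<Phi> :: 'a list \<Rightarrow> 'b. \<forall>x\<in>X. \<forall>i. \<phi> x i = \<Phi> (block x (i - m) (i + n))))"

definition one_to_one_ae ::
    "'a biseq set \<Rightarrow> 'b biseq set \<Rightarrow> ('a biseq \<Rightarrow> 'b biseq) \<Rightarrow> bool" where
  "one_to_one_ae X Y \<phi> \<longleftrightarrow> (\<forall>y. doubly_transitive Y y \<longrightarrow> (\<exists>!x. x \<in> X \<and> \<phi> x = y))"

definition right_closing_ae :: "'a biseq set \<Rightarrow> ('a biseq \<Rightarrow> 'b biseq) \<Rightarrow> bool" where
  "right_closing_ae X \<phi> \<longleftrightarrow>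
     (\<exists>n::nat. \<forall>x y. left_transitive X x \<longrightarrow> left_transitive X y \<longrightarrow>
        (\<forall>i\<le>0. x i = y i) \<longrightarrow> (\<forall>i\<le>int n. \<phi> x i = \<phi> y i) \<longrightarrow> x 1 = y 1)"

definition decoder_block ::
    "'a biseq set \<Rightarrow> 'b biseq set \<Rightarrow> ('a biseq \<Rightarrow> 'b biseq) \<Rightarrow> 'b list \<Rightarrow> bool" where
  "decoder_block X Y \<phi> w \<longleftrightarrow>
     w \<in> language Y \<and>
     (\<exists>k::nat. \<forall>n::nat. \<forall>x\<in>X. \<forall>y\<in>X.
        block (\<phi> x) (- int (length w) + 1) 0 = w \<longrightarrow>
        block (\<phi> y) (- int (length w) + 1) 0 = w \<longrightarrow>
        block (\<phi> x) 1 (int (n + k)) = block (\<phi> y) 1 (int (n + k)) \<longrightarrow>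
        block x 1 (int n) = block y 1 (int n))"

end

theory Submission
  imports Defs
begin

text \<open>A decoder block gives both properties because a doubly transitive point of \<open>Y\<close>, or the
  image of a left-transitive point of \<open>X\<close>, shows the block arbitrarily far to the left: from such
  an occurrence on, the preimage is determined up to the anticipation.

  The converse rests on the doubly transitive point \<open>z\<close> of \<open>half_synchronized_splice\<close>, whose left
  half \<open>z\<^bsub>(-\<infinity>,0]\<^esub>\<close> has the follower set of a finite block \<open>m\<close> ending at coordinate \<open>0\<close>.  The point
  \<open>\<phi> z\<close> is doubly transitive, so it has only the preimage \<open>z\<close>, and by compactness
  (\<open>unique_preimage_window\<close>) a central block \<open>w\<close> of \<open>\<phi> z\<close> already forces every preimage to agree
  with \<open>z\<close> on a prescribed window around \<open>0\<close>, in particular to show \<open>m\<close> there.  This \<open>w\<close> is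
  the decoder block.  Indeed, if \<open>x\<close> and \<open>y\<close> are mapped to points that show \<open>w\<close> at the same place,
  their right halves follow \<open>m\<close>, so their left halves may both be replaced by that of \<open>z\<close>.  The two
  new points are left-transitive and have a common past, and their images agree to the left as well
  as wherever \<open>\<phi> x\<close> and \<open>\<phi> y\<close> agree to the right.  Right-closing almost everywhere, applied one
  coordinate at a time, then recovers their common future, which is that of \<open>x\<close> and \<open>y\<close>.\<close>

section \<open>Occurrences of blocks\<close>

definition occurs_at :: "'a list \<Rightarrow> 'a biseq \<Rightarrow> int \<Rightarrow> bool" where
  "occurs_at u x i \<longleftrightarrow> (\<forall>k<length u. x (i + int k) = u ! k)"

lemma length_block [simp]: "length (block x i j) = nat (j - i + 1)"
  by (simp add: block_def)

lemma nth_block: "k < nat (j - i + 1) \<Longrightarrow> block x i j ! k = x (i + int k)"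
  by (simp add: block_def)

lemma block_eq_iff_occurs_at:
  assumes "j = i + int (length u) - 1"
  shows "block x i j = u \<longleftrightarrow> occurs_at u x i"
  using assms by (auto simp: list_eq_iff_nth_eq nth_block occurs_at_def)

lemma occurs_at_block: "occurs_at (block x i j) x i"
  by (simp add: occurs_at_def nth_block)

lemma block_eq_block_iff:
  "block x i j = block y i j \<longleftrightarrow> (\<forall>l. i \<le> l \<and> l \<le> j \<longrightarrow> x l = y l)"
  by (auto simp: block_def)

lemma occurs_at_append:
  "occurs_at (u @ v) x i \<longleftrightarrow> occurs_at u x i \<and> occurs_at v x (i + int (length u))"
proof
  assume *: "occurs_at (u @ v) x i"
  have "x (i + int (length u) + int k) = v ! k" if "k < length v" for k
    using *[unfolded occurs_at_def, rule_format, of "length u + k"] that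
    by (simp add: nth_append algebra_simps)
  moreover have "x (i + int k) = u ! k" if "k < length u" for k
    using *[unfolded occurs_at_def, rule_format, of k] that by (simp add: nth_append)
  ultimately show "occurs_at u x i \<and> occurs_at v x (i + int (length u))"
    by (simp add: occurs_at_def)
next
  assume *: "occurs_at u x i \<and> occurs_at v x (i + int (length u))"
  show "occurs_at (u @ v) x i"
    unfolding occurs_at_def
  proof (intro allI impI)
    fix k assume k: "k < length (u @ v)"
    show "x (i + int k) = (u @ v) ! k"
    proof (cases "k < length u")
      case True
      then show ?thesis using * by (simp add: occurs_at_def nth_append)
    next
      case False
      then have "x (i + int (length u) + int (k - length u)) = v ! (k - length u)"
        using *[unfolded occurs_at_def, THEN conjunct2, rule_format, of "k - length u"] k
        by (simp add: less_diff_conv2)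
      moreover have "i + int (length u) + int (k - length u) = i + int k"
        using False by simp
      ultimately show ?thesis using False by (simp add: nth_append)
    qed
  qed
qed

lemma occurs_at_translate: "occurs_at u (\<lambda>l. x (l + c)) i \<longleftrightarrow> occurs_at u x (i + c)"
  by (simp add: occurs_at_def algebra_simps)

lemma occurs_at_cong:
  assumes "\<And>l. i \<le> l \<Longrightarrow> l < i + int (length u) \<Longrightarrow> x l = y l"
  shows "occurs_at u x i \<longleftrightarrow> occurs_at u y i"
  using assms by (auto simp: occurs_at_def)

lemma language_iff: "u \<in> language X \<longleftrightarrow> (\<exists>x\<in>X. \<exists>i. occurs_at u x i)"
proof
  assume "u \<in> language X"
  then obtain n x i where x: "x \<in> X" and u: "u = block x i (i + int n - 1)"
    by (auto simp: language_def blocks_def)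
  show "\<exists>x\<in>X. \<exists>i. occurs_at u x i"
    unfolding u using x occurs_at_block by blast
next
  assume "\<exists>x\<in>X. \<exists>i. occurs_at u x i"
  then obtain x i where "x \<in> X" "occurs_at u x i" by blast
  then have "u = block x i (i + int (length u) - 1)"
    using block_eq_iff_occurs_at[OF refl, of x i u] by simp
  then show "u \<in> language X"
    using \<open>x \<in> X\<close> unfolding language_def blocks_def by blast
qed

lemma block_in_language: "x \<in> X \<Longrightarrow> block x i j \<in> language X"
  using language_iff occurs_at_block by blast

lemma infinite_nonpos_iff: "infinite {i::int. i \<le> 0 \<and> P i} \<longleftrightarrow> (\<forall>N. \<exists>i\<le>N. P i)"
proof
  assume inf: "infinite {i. i \<le> 0 \<and> P i}"
  show "\<forall>N. \<exists>i\<le>N. P i"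
  proof (rule ccontr)
    assume "\<not> ?thesis"
    then obtain N where "\<And>i. i \<le> N \<Longrightarrow> \<not> P i" by blast
    then have "{i. i \<le> 0 \<and> P i} \<subseteq> {N..0}" by (auto simp: not_less intro: ccontr)
    then show False using inf finite_subset by blast
  qed
next
  assume *: "\<forall>N. \<exists>i\<le>N. P i"
  show "infinite {i. i \<le> 0 \<and> P i}"
  proof
    assume fin: "finite {i. i \<le> 0 \<and> P i}"
    obtain i where i: "i \<le> min 0 (Min {i. i \<le> 0 \<and> P i}) - 1" "P i" using * by blast
    then have "Min {i. i \<le> 0 \<and> P i} \<le> i" using fin by simp
    then show False using i by linarith
  qed
qed

lemma infinite_nonneg_iff: "infinite {i::int. i \<ge> 0 \<and> P i} \<longleftrightarrow> (\<forall>N. \<exists>i\<ge>N. P i)"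
proof -
  have "{i. i \<le> 0 \<and> P (- i)} = uminus ` {i. i \<ge> 0 \<and> P i}"
    by (force simp: image_iff intro: exI[of _ "- x" for x])
  then have "infinite {i. i \<ge> 0 \<and> P i} \<longleftrightarrow> infinite {i. i \<le> 0 \<and> P (- i)}"
    by (simp add: finite_image_iff)
  also have "\<dots> \<longleftrightarrow> (\<forall>N. \<exists>i\<le>N. P (- i))"
    by (rule infinite_nonpos_iff)
  also have "\<dots> \<longleftrightarrow> (\<forall>N. \<exists>i\<ge>N. P i)"
    by (metis minus_le_iff minus_minus le_minus_iff)
  finally show ?thesis .
qed

lemma left_transitive_iff:
  "left_transitive X x \<longleftrightarrow> x \<in> X \<and> (\<forall>u\<in>language X. \<forall>N. \<exists>i\<le>N. occurs_at u x i)"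
  unfolding left_transitive_def infinite_nonpos_iff by (simp add: block_eq_iff_occurs_at)

lemma doubly_transitive_iff:
  "doubly_transitive X x \<longleftrightarrow>
     left_transitive X x \<and> (\<forall>u\<in>language X. \<forall>N. \<exists>i\<ge>N. occurs_at u x i)"
  unfolding doubly_transitive_def infinite_nonneg_iff by (simp add: block_eq_iff_occurs_at)

lemma left_transitive_cong:
  assumes "left_transitive X x" and "y \<in> X" and "\<And>i. i \<le> 0 \<Longrightarrow> y i = x i"
  shows "left_transitive X y"
  unfolding left_transitive_iff
proof (intro conjI ballI allI)
  fix u N assume "u \<in> language X"
  then obtain i where "i \<le> min N (- int (length u))" "occurs_at u x i"
    using assms(1) unfolding left_transitive_iff by blast
  moreover from this have "occurs_at u y i"
    by (subst occurs_at_cong[of _ _ y x]) (auto intro: assms(3))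
  ultimately show "\<exists>i\<le>N. occurs_at u y i" by auto
qed (fact assms(2))

section \<open>Translation and compactness\<close>

lemma subshift_translate:
  assumes "subshift A X" and "x \<in> X"
  shows "(\<lambda>i. x (i + c)) \<in> X"
proof (induction c rule: int_induct[where k = 0])
  case base
  then show ?case using assms by simp
next
  case (step1 c)
  then have "shift_map (\<lambda>i. x (i + c)) \<in> X" using assms by (auto simp: subshift_def)
  then show ?case by (simp add: shift_map_def algebra_simps)
next
  case (step2 c)
  then obtain x' where x': "x' \<in> X" "(\<lambda>i. x (i + c)) = shift_map x'"
    using assms(1) by (auto simp: subshift_def)
  have "x' i = x (i + (c - 1))" for i
    using fun_cong[OF x'(2), of "i - 1"] by (simp add: shift_map_def algebra_simps)
  then have "x' = (\<lambda>i. x (i + (c - 1)))" by blast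
  then show ?case using x' by simp
qed

lemma left_transitive_translate:
  assumes "subshift A X" and "left_transitive X x"
  shows "left_transitive X (\<lambda>i. x (i + c))"
  unfolding left_transitive_iff occurs_at_translate
proof (intro conjI ballI allI)
  show "(\<lambda>i. x (i + c)) \<in> X"
    using assms subshift_translate unfolding left_transitive_iff by blast
  fix u N assume "u \<in> language X"
  then obtain i where "i \<le> N + c" "occurs_at u x i"
    using assms(2) unfolding left_transitive_iff by blast
  then show "\<exists>i\<le>N. occurs_at u x (i + c)"
    by (intro exI[of _ "i - c"]) simp
qed

text \<open>Compactness in combinatorial form.  The full shift over a finite alphabet is compact, so the
  closures of the tails of \<open>s\<close> have a common point; it lies in \<open>X\<close> because \<open>X\<close> is closed, and its
  central cylinders are open and hence meet every tail.\<close>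

lemma subshift_cluster_point:
  fixes s :: "nat \<Rightarrow> 'a biseq"
  assumes "subshift A X" and "\<And>n. s n \<in> X"
  obtains x where "x \<in> X" and "\<And>N. \<exists>n\<ge>N. \<forall>i. \<bar>i\<bar> \<le> int N \<longrightarrow> x i = s n i"
proof -
  define T :: "'a biseq topology" where "T = product_topology (\<lambda>_. discrete_topology A) UNIV"
  have closed: "closedin T X" and "finite A" using assms(1) by (auto simp: subshift_def T_def)
  then have "compact_space T"
    by (simp add: T_def compact_space_product_topology compact_space_discrete_topology)
  moreover have sub: "s ` {n..} \<subseteq> topspace T" for n
    using closedin_subset[OF closed] assms(2) by blast
  have "T closure_of (s ` {n..}) \<noteq> {}" for n
    using closure_of_subset[OF sub[of n]] by fastforce
  moreover have "decseq (\<lambda>n. T closure_of (s ` {n..}))"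
    by (auto simp: decseq_def intro!: closure_of_mono)
  ultimately have "(\<Inter>n. T closure_of (s ` {n..})) \<noteq> {}"
    by (intro compact_space_imp_nest) auto
  then obtain x where x: "\<And>n. x \<in> T closure_of (s ` {n..})" by blast
  have "T closure_of (s ` {0..}) \<subseteq> X"
    using assms(2) closed by (intro closure_of_minimal) auto
  then have "x \<in> X" using x by blast
  moreover have "\<exists>n\<ge>N. \<forall>i. \<bar>i\<bar> \<le> int N \<longrightarrow> x i = s n i" for N
  proof -
    have xA: "x i \<in> A" for i
      using closedin_subset[OF closed] \<open>x \<in> X\<close> by (auto simp: T_def PiE_iff)
    define U where "U = (\<Pi>\<^sub>E i\<in>UNIV. if \<bar>i\<bar> \<le> int N then {x i} else A)"
    have "finite {i. (if \<bar>i\<bar> \<le> int N then {x i} else A) \<noteq> topspace (discrete_topology A)}"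
      by (rule finite_subset[of _ "{- int N..int N}"]) auto
    then have "openin T U"
      unfolding T_def U_def by (intro product_topology_basis) (auto simp: xA)
    moreover have "x \<in> U" by (auto simp: U_def xA)
    ultimately obtain p where "p \<in> U" "p \<in> s ` {N..}"
      using x[of N] unfolding in_closure_of by blast
    then obtain n where n: "n \<ge> N" "s n \<in> U" by auto
    have "x i = s n i" if "\<bar>i\<bar> \<le> int N" for i
      using n(2) that by (auto simp: U_def PiE_iff dest: spec[of _ i])
    then show ?thesis using n(1) by blast
  qed
  ultimately show thesis using that by blast
qed

lemma countable_language:
  assumes "subshift A X"
  shows "countable (language X)"
proof -
  have "X \<subseteq> (\<Pi>\<^sub>E i\<in>UNIV. A)"
    using assms closedin_subset unfolding subshift_def by fastforce
  then have xA: "x i \<in> A" if "x \<in> X" for x i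
    using that by (auto simp: PiE_iff)
  have "language X \<subseteq> lists A"
    using xA by (auto simp: language_def blocks_def block_def)
  moreover have "countable A" using assms by (simp add: subshift_def countable_finite)
  ultimately show ?thesis using countable_lists countable_subset by blast
qed

section \<open>Transitive right rays\<close>

text \<open>Transitivity lets one append all blocks of the language, one after the other, to a given block
  \<open>q\<close>; the limit is a point that starts with \<open>q\<close> and shows each block at least once to the right.\<close>

lemma transitive_exhausting_point:
  assumes X: "subshift A X" and tr: "transitive X" and q: "q \<in> language X"
  obtains p where "p \<in> X" and "occurs_at q p 0"
    and "\<And>u. u \<in> language X \<Longrightarrow> \<exists>i\<ge>0. occurs_at u p i"
proof -
  define e where "e = from_nat_into (language X)"
  have e: "e k \<in> language X" for k
    unfolding e_def using q by (intro from_nat_into) auto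
  define step where "step v k = v @ (SOME g. v @ g @ e k \<in> language X) @ e k" for v k
  have step: "step v k \<in> language X" if "v \<in> language X" for v k
    unfolding step_def using tr that e[of k] unfolding transitive_def by (metis someI_ex)
  define v where "v = rec_nat q (\<lambda>k v. step v k)"
  have v0: "v 0 = q" and vS: "v (Suc k) = step (v k) k" for k
    by (simp_all add: v_def)
  have vX: "v k \<in> language X" for k
    by (induction k) (simp_all add: v0 vS q step)
  have prefix: "\<exists>r. v l = v k @ r" if "k \<le> l" for k l
    using that
  proof (induction rule: dec_induct)
    case (step n)
    then show ?case by (auto simp: vS step_def)
  qed simp
  have "\<exists>x\<in>X. occurs_at (v k) x 0" for k
  proof -
    obtain x i where "x \<in> X" "occurs_at (v k) x i" using vX language_iff by blast
    then show ?thesis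
      using subshift_translate[OF X, of x i] occurs_at_translate[of "v k" x i 0] by auto
  qed
  then obtain s where s: "\<And>k. s k \<in> X" "\<And>k. occurs_at (v k) (s k) 0" by metis
  obtain p where p: "p \<in> X" "\<And>N. \<exists>n\<ge>N. \<forall>i. \<bar>i\<bar> \<le> int N \<longrightarrow> p i = s n i"
    using subshift_cluster_point[of A X s, OF X s(1)] by blast
  have pv: "occurs_at (v k) p 0" for k
  proof -
    obtain n where n: "n \<ge> max k (length (v k))"
        "\<forall>i. \<bar>i\<bar> \<le> int (max k (length (v k))) \<longrightarrow> p i = s n i"
      using p(2) by blast
    obtain r where "v n = v k @ r" using prefix[of k n] n(1) by auto
    then have "occurs_at (v k) (s n) 0" using s(2)[of n] by (simp add: occurs_at_append)
    then show ?thesis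
      using n(2) by (subst occurs_at_cong[of _ _ p "s n"]) auto
  qed
  have "\<exists>i\<ge>0. occurs_at u p i" if u: "u \<in> language X" for u
  proof -
    obtain k where k: "e k = u"
      unfolding e_def using from_nat_into_surj[OF countable_language[OF X] u] by blast
    define g where "g = (SOME g. v k @ g @ e k \<in> language X)"
    have "v (Suc k) = (v k @ g) @ u"
      by (simp add: vS step_def g_def k)
    then have "occurs_at u p (0 + int (length (v k @ g)))"
      using pv[of "Suc k"] occurs_at_append[of "v k @ g" u p 0] by simp
    then show ?thesis by (intro exI[of _ "0 + int (length (v k @ g))"]) simp
  qed
  then show thesis using that p(1) pv[of 0] v0 by simp
qed

text \<open>Showing each block once is enough: an occurrence of a block that extends the first \<open>N\<close> symbols
  of the ray and ends with \<open>u\<close> contains an occurrence of \<open>u\<close> beyond coordinate \<open>N\<close>.\<close>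

lemma transitive_right_ray:
  assumes X: "subshift A X" and tr: "transitive X" and q: "q \<in> language X"
  obtains p where "p \<in> X" and "occurs_at q p 0"
    and "\<And>u N. u \<in> language X \<Longrightarrow> \<exists>i\<ge>N. occurs_at u p i"
proof -
  obtain p where p: "p \<in> X" "occurs_at q p 0"
      "\<And>u. u \<in> language X \<Longrightarrow> \<exists>i\<ge>0. occurs_at u p i"
    using transitive_exhausting_point[OF X tr q] by blast
  have "\<exists>i\<ge>N. occurs_at u p i" if u: "u \<in> language X" for u N
  proof -
    have "block p 1 N \<in> language X" using p(1) by (rule block_in_language)
    then obtain g where g: "block p 1 N @ g @ u \<in> language X"
      using tr u unfolding transitive_def by blast
    then obtain i where i: "i \<ge> 0" "occurs_at (block p 1 N @ g @ u) p i"
      using p(3) by blast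
    then have "occurs_at u p (i + int (length (block p 1 N)) + int (length g))"
      by (simp add: occurs_at_append)
    then show ?thesis using i(1)
      by (intro exI[of _ "i + int (length (block p 1 N)) + int (length g)"]) simp
  qed
  then show thesis using that p by blast
qed

section \<open>Half-synchronized systems\<close>

definition splice :: "'a biseq \<Rightarrow> 'a biseq \<Rightarrow> 'a biseq" where
  "splice x y = (\<lambda>i. if i \<le> 0 then x i else y i)"

lemma follower_ray_eq_block_splice:
  assumes X: "subshift A X"
    and m: "occurs_at m x (1 - int (length m))"
    and foll: "follower_ray X (left_ray x) = follower_block X m"
    and y: "y \<in> X" and xy: "\<And>i. - int (length m) < i \<Longrightarrow> i \<le> 0 \<Longrightarrow> y i = x i"
  shows "splice x y \<in> X"
proof -
  define r where "r = (\<lambda>k. y (int k + 1))"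
  have "r = right_ray (\<lambda>i. y (i + 1))" by (simp add: r_def right_ray_def)
  then have "r \<in> right_rays X"
    unfolding right_rays_def using subshift_translate[OF X y, of 1] by blast
  moreover have "(\<lambda>k. y (1 - int (length m) + int k)) = m \<frown> r"
  proof
    fix k
    show "y (1 - int (length m) + int k) = (m \<frown> r) k"
    proof (cases "k < length m")
      case True
      then have "y (1 - int (length m) + int k) = x (1 - int (length m) + int k)"
        by (intro xy) auto
      then show ?thesis using True m by (simp add: conc_def occurs_at_def)
    next
      case False
      then show ?thesis by (simp add: conc_def r_def of_nat_diff algebra_simps)
    qed
  qed
  ultimately have "r \<in> follower_block X m"
    unfolding follower_block_def using y by blast
  then have "join_rays (left_ray x) r \<in> X"
    using foll by (auto simp: follower_ray_def)
  moreover have "join_rays (left_ray x) r = splice x y"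
    by (auto simp: join_rays_def left_ray_def r_def splice_def)
  ultimately show ?thesis by simp
qed

text \<open>The left half of the point that witnesses half-synchronization, continued by a transitive right
  ray.  The continuation is legal because it continues the synchronizing block.\<close>

lemma half_synchronized_splice:
  assumes X: "subshift A X" and hs: "half_synchronized X"
  obtains z L where "doubly_transitive X z"
    and "\<And>x. x \<in> X \<Longrightarrow> (\<And>i. - int L < i \<Longrightarrow> i \<le> 0 \<Longrightarrow> x i = z i) \<Longrightarrow> splice z x \<in> X"
proof -
  obtain m x where tr: "transitive X" and mX: "m \<in> language X" and lt: "left_transitive X x"
    and "block x (- int (length m) + 1) 0 = m"
    and foll: "follower_ray X (left_ray x) = follower_block X m"
    using hs unfolding half_synchronized_def by blast
  then have m: "occurs_at m x (1 - int (length m))"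
    using block_eq_iff_occurs_at[of 0 "- int (length m) + 1" m x] by simp
  have spl: "splice x y \<in> X"
    if "y \<in> X" "\<And>i. - int (length m) < i \<Longrightarrow> i \<le> 0 \<Longrightarrow> y i = x i" for y
    using follower_ray_eq_block_splice[OF X m foll that] .
  obtain p' where p': "p' \<in> X" "occurs_at m p' 0"
      "\<And>u N. u \<in> language X \<Longrightarrow> \<exists>i\<ge>N. occurs_at u p' i"
    using transitive_right_ray[OF X tr mX] by blast
  define p where "p = (\<lambda>i. p' (i + (int (length m) - 1)))"
  have pX: "p \<in> X" unfolding p_def by (rule subshift_translate[OF X p'(1)])
  have pm: "p i = x i" if "- int (length m) < i" "i \<le> 0" for i
    using p'(2)[unfolded occurs_at_def, rule_format, of "nat (i + int (length m) - 1)"]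
      m[unfolded occurs_at_def, rule_format, of "nat (i + int (length m) - 1)"] that
    by (simp add: p_def algebra_simps)
  define z where "z = splice x p"
  have zX: "z \<in> X" unfolding z_def by (rule spl[OF pX pm])
  have "left_transitive X z"
    by (rule left_transitive_cong[OF lt zX]) (simp add: z_def splice_def)
  moreover have "\<exists>i\<ge>N. occurs_at u z i" if u: "u \<in> language X" for u N
  proof -
    obtain i where i: "i \<ge> max 1 N + int (length m)" "occurs_at u p' i"
      using p'(3)[OF u] by blast
    define j where "j = i - (int (length m) - 1)"
    have "occurs_at u p j"
      unfolding p_def occurs_at_translate using i(2) by (simp add: j_def)
    then have "occurs_at u z j"
      using i(1) by (subst occurs_at_cong[of _ _ z p]) (auto simp: z_def splice_def j_def)
    then show ?thesis using i(1) by (intro exI[of _ j]) (simp add: j_def)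
  qed
  ultimately have "doubly_transitive X z" unfolding doubly_transitive_iff by blast
  moreover have "splice z y \<in> X"
    if "y \<in> X" "\<And>i. - int (length m) < i \<Longrightarrow> i \<le> 0 \<Longrightarrow> y i = z i" for y
  proof -
    have "splice x y \<in> X" using that by (intro spl) (simp_all add: z_def splice_def)
    moreover have "splice x y = splice z y" by (auto simp: z_def splice_def)
    ultimately show ?thesis by simp
  qed
  ultimately show thesis using that by blast
qed

section \<open>Sliding block codes\<close>

text \<open>A block map with a symmetric window.  Two independent coordinates \<open>i\<close> and \<open>j\<close> express
  that the block map is the same everywhere, that is, that \<open>\<phi>\<close> commutes with the shift.\<close>

definition coding_radius :: "'a biseq set \<Rightarrow> ('a biseq \<Rightarrow> 'b biseq) \<Rightarrow> nat \<Rightarrow> bool" where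
  "coding_radius X \<phi> M \<longleftrightarrow>
     (\<forall>x\<in>X. \<forall>y\<in>X. \<forall>i j. (\<forall>k. \<bar>k\<bar> \<le> int M \<longrightarrow> x (i + k) = y (j + k)) \<longrightarrow> \<phi> x i = \<phi> y j)"

lemma coding_radiusD:
  assumes "coding_radius X \<phi> M" "x \<in> X" "y \<in> X"
    and "\<And>k. \<bar>k\<bar> \<le> int M \<Longrightarrow> x (i + k) = y (j + k)"
  shows "\<phi> x i = \<phi> y j"
  using assms unfolding coding_radius_def by blast

lemma factor_map_coding_radius:
  assumes "factor_map X Y \<phi>"
  obtains M where "coding_radius X \<phi> M"
proof -
  obtain m n :: int and \<Phi> where \<Phi>: "\<And>x i. x \<in> X \<Longrightarrow> \<phi> x i = \<Phi> (block x (i - m) (i + n))"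
    using assms unfolding factor_map_def by blast
  have "coding_radius X \<phi> (nat (max \<bar>m\<bar> \<bar>n\<bar>))"
    unfolding coding_radius_def
  proof (intro ballI allI impI)
    fix x y i j
    assume xy: "x \<in> X" "y \<in> X"
      and *: "\<forall>k. \<bar>k\<bar> \<le> int (nat (max \<bar>m\<bar> \<bar>n\<bar>)) \<longrightarrow> x (i + k) = y (j + k)"
    have "block x (i - m) (i + n) = block y (j - m) (j + n)"
    proof (rule nth_equalityI)
      fix k assume "k < length (block x (i - m) (i + n))"
      then have k: "int k < n + m + 1" by simp
      then have "x (i + (int k - m)) = y (j + (int k - m))"
        by (intro *[rule_format]) linarith
      then show "block x (i - m) (i + n) ! k = block y (j - m) (j + n) ! k"
        using k by (simp add: nth_block algebra_simps)
    qed simp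
    then show "\<phi> x i = \<phi> y j" using \<Phi> xy by metis
  qed
  then show thesis using that by blast
qed

lemma coding_radius_translate:
  assumes "subshift A X" "coding_radius X \<phi> M" "x \<in> X"
  shows "\<phi> (\<lambda>i. x (i + c)) l = \<phi> x (l + c)"
  using assms subshift_translate[OF assms(1,3), of c]
  by (intro coding_radiusD[OF assms(2)]) (simp_all add: algebra_simps)

text \<open>Widening an occurrence of \<open>u\<close> by the radius gives a block of \<open>X\<close> that codes to \<open>u\<close> wherever
  it occurs; hence transitivity passes to the image.\<close>

lemma language_image_lift:
  assumes cr: "coding_radius X \<phi> M" and u: "u \<in> language (\<phi> ` X)"
  obtains v where "v \<in> language X"
    and "\<And>z j. z \<in> X \<Longrightarrow> occurs_at v z j \<Longrightarrow> occurs_at u (\<phi> z) (j + int M)"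
proof -
  obtain x i where x: "x \<in> X" and ux: "occurs_at u (\<phi> x) i"
    using u unfolding language_iff by blast
  define v where "v = block x (i - int M) (i + int (length u) - 1 + int M)"
  have "occurs_at u (\<phi> z) (j + int M)" if z: "z \<in> X" and v: "occurs_at v z j" for z j
    unfolding occurs_at_def
  proof (intro allI impI)
    fix k assume k: "k < length u"
    have "\<phi> z (j + int M + int k) = \<phi> x (i + int k)"
    proof (rule coding_radiusD[OF cr z x])
      fix l assume l: "\<bar>l\<bar> \<le> int M"
      define t where "t = nat (int M + int k + l)"
      have t: "int t = int M + int k + l" and tl: "t < length v"
        using l k by (auto simp: t_def v_def)
      have "z (j + int t) = v ! t" using v tl by (simp add: occurs_at_def)
      also have "\<dots> = x (i - int M + int t)"
        unfolding v_def using tl by (intro nth_block) (simp add: v_def)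
      finally show "z (j + int M + int k + l) = x (i + int k + l)"
        by (simp add: t algebra_simps)
    qed
    then show "\<phi> z (j + int M + int k) = u ! k" using ux k by (simp add: occurs_at_def)
  qed
  then show thesis using that x block_in_language unfolding v_def by blast
qed

lemma left_transitive_image:
  assumes cr: "coding_radius X \<phi> M" and z: "left_transitive X z"
  shows "left_transitive (\<phi> ` X) (\<phi> z)"
  unfolding left_transitive_iff
proof (intro conjI ballI allI)
  have zX: "z \<in> X" using z by (simp add: left_transitive_iff)
  then show "\<phi> z \<in> \<phi> ` X" by blast
  fix u N assume "u \<in> language (\<phi> ` X)"
  then obtain v where v: "v \<in> language X"
      "\<And>z j. z \<in> X \<Longrightarrow> occurs_at v z j \<Longrightarrow> occurs_at u (\<phi> z) (j + int M)"
    using language_image_lift[OF cr] by blast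
  obtain j where "j \<le> N - int M" "occurs_at v z j"
    using z v(1) unfolding left_transitive_iff by blast
  then show "\<exists>i\<le>N. occurs_at u (\<phi> z) i"
    using v(2)[OF zX] by (intro exI[of _ "j + int M"]) simp
qed

lemma doubly_transitive_image:
  assumes cr: "coding_radius X \<phi> M" and z: "doubly_transitive X z"
  shows "doubly_transitive (\<phi> ` X) (\<phi> z)"
  unfolding doubly_transitive_iff
proof (intro conjI ballI allI)
  show "left_transitive (\<phi> ` X) (\<phi> z)"
    using left_transitive_image[OF cr] z by (simp add: doubly_transitive_iff)
  have zX: "z \<in> X" using z by (simp add: doubly_transitive_iff left_transitive_iff)
  fix u N assume "u \<in> language (\<phi> ` X)"
  then obtain v where v: "v \<in> language X"
      "\<And>z j. z \<in> X \<Longrightarrow> occurs_at v z j \<Longrightarrow> occurs_at u (\<phi> z) (j + int M)"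
    using language_image_lift[OF cr] by blast
  obtain j where "j \<ge> N" "occurs_at v z j"
    using z v(1) unfolding doubly_transitive_iff by blast
  then show "\<exists>i\<ge>N. occurs_at u (\<phi> z) i"
    using v(2)[OF zX] by (intro exI[of _ "j + int M"]) simp
qed

text \<open>If no window sufficed, points with longer and longer correct central image blocks but a wrong
  central block would cluster at a second preimage.\<close>

lemma unique_preimage_window:
  fixes L :: nat
  assumes X: "subshift A X" and cr: "coding_radius X \<phi> M"
    and unique: "\<And>x. x \<in> X \<Longrightarrow> \<phi> x = \<phi> z \<Longrightarrow> x = z"
  obtains N :: nat where "\<And>x i. x \<in> X \<Longrightarrow> (\<And>l. \<bar>l\<bar> \<le> int N \<Longrightarrow> \<phi> x l = \<phi> z l)
    \<Longrightarrow> \<bar>i\<bar> \<le> int L \<Longrightarrow> x i = z i"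
proof (rule ccontr)
  assume no: "\<not> thesis"
  have "\<exists>x\<in>X. (\<forall>l. \<bar>l\<bar> \<le> int N \<longrightarrow> \<phi> x l = \<phi> z l) \<and> (\<exists>i. \<bar>i\<bar> \<le> int L \<and> x i \<noteq> z i)" for N
    using no that[of N] by blast
  then obtain s where s: "\<And>N. s N \<in> X"
      "\<And>N l. \<bar>l\<bar> \<le> int N \<Longrightarrow> \<phi> (s N) l = \<phi> z l"
      "\<And>N. \<exists>i. \<bar>i\<bar> \<le> int L \<and> s N i \<noteq> z i"
    by metis
  obtain x where x: "x \<in> X" "\<And>N. \<exists>n\<ge>N. \<forall>i. \<bar>i\<bar> \<le> int N \<longrightarrow> x i = s n i"
    using subshift_cluster_point[of A X s, OF X s(1)] by blast
  have "\<phi> x i = \<phi> z i" for i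
  proof -
    obtain n where n: "n \<ge> nat \<bar>i\<bar> + M" "\<forall>l. \<bar>l\<bar> \<le> int (nat \<bar>i\<bar> + M) \<longrightarrow> x l = s n l"
      using x(2) by blast
    have "\<phi> x i = \<phi> (s n) i"
      by (rule coding_radiusD[OF cr x(1) s(1)]) (use n(2) in auto)
    also have "\<dots> = \<phi> z i" using n(1) by (intro s(2)) linarith
    finally show ?thesis .
  qed
  then have "x = z" using unique[OF x(1)] by blast
  moreover obtain n where "\<forall>i. \<bar>i\<bar> \<le> int L \<longrightarrow> x i = s n i" using x(2) by blast
  ultimately show False using s(3)[of n] by metis
qed

section \<open>From a decoder block to the two properties\<close>

text \<open>By shift-invariance the decoder block may occur anywhere; the anticipation costs the last \<open>k\<close>
  coordinates of the range on which the images agree.\<close>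

lemma decoder_block_decodes:
  assumes X: "subshift A X" and cr: "coding_radius X \<phi> M" and "decoder_block X Y \<phi> w"
  obtains k :: nat where "\<And>x y i j l. x \<in> X \<Longrightarrow> y \<in> X \<Longrightarrow> occurs_at w (\<phi> x) i \<Longrightarrow>
      (\<And>l. i \<le> l \<Longrightarrow> l \<le> j + int k \<Longrightarrow> \<phi> x l = \<phi> y l) \<Longrightarrow>
      i + int (length w) \<le> l \<Longrightarrow> l \<le> j \<Longrightarrow> x l = y l"
proof -
  obtain k :: nat where k: "\<And>n x y. x \<in> X \<Longrightarrow> y \<in> X \<Longrightarrow>
        block (\<phi> x) (- int (length w) + 1) 0 = w \<Longrightarrow>
        block (\<phi> y) (- int (length w) + 1) 0 = w \<Longrightarrow>
        block (\<phi> x) 1 (int (n + k)) = block (\<phi> y) 1 (int (n + k)) \<Longrightarrow>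
        block x 1 (int n) = block y 1 (int n)"
    using assms(3) unfolding decoder_block_def by blast
  have w0: "block p (- int (length w) + 1) 0 = w \<longleftrightarrow> occurs_at w p (- int (length w) + 1)" for p
    by (rule block_eq_iff_occurs_at) simp
  have "x l = y l"
    if x: "x \<in> X" and y: "y \<in> X" and w: "occurs_at w (\<phi> x) i"
      and agree: "\<And>l. i \<le> l \<Longrightarrow> l \<le> j + int k \<Longrightarrow> \<phi> x l = \<phi> y l"
      and l: "i + int (length w) \<le> l" "l \<le> j" for x y i j l
  proof -
    \<comment> \<open>Translate the last symbol of \<open>w\<close> to coordinate \<open>0\<close>.\<close>
    define c where "c = i + int (length w) - 1"
    define n where "n = nat (j - c)"
    define x' where "x' = (\<lambda>t. x (t + c))"
    define y' where "y' = (\<lambda>t. y (t + c))"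
    have x'X: "x' \<in> X" and y'X: "y' \<in> X"
      unfolding x'_def y'_def using subshift_translate[OF X] x y by auto
    have px: "\<phi> x' t = \<phi> x (t + c)" and py: "\<phi> y' t = \<phi> y (t + c)" for t
      unfolding x'_def y'_def using coding_radius_translate[OF X cr] x y by auto
    have n: "int n = j - c" using l by (simp add: n_def c_def)
    have wx': "occurs_at w (\<phi> x') (- int (length w) + 1)"
      using w by (simp add: occurs_at_def px c_def algebra_simps)
    moreover have "occurs_at w (\<phi> y') (- int (length w) + 1)"
      using wx' agree l by (subst occurs_at_cong[of _ _ _ "\<phi> x'"]) (auto simp: px py c_def)
    moreover have "block (\<phi> x') 1 (int (n + k)) = block (\<phi> y') 1 (int (n + k))"
      unfolding block_eq_block_iff px py using n by (auto intro!: agree simp: c_def)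
    ultimately have "block x' 1 (int n) = block y' 1 (int n)"
      by (intro k[OF x'X y'X]) (simp_all only: w0)
    then have "x' (l - c) = y' (l - c)"
      unfolding block_eq_block_iff using l n by (auto simp: c_def)
    then show ?thesis by (simp add: x'_def y'_def)
  qed
  then show thesis using that by blast
qed

lemma decoder_block_imp_right_closing_ae:
  assumes X: "subshift A X" and cr: "coding_radius X \<phi> M" and Y: "\<phi> ` X = Y"
    and w: "decoder_block X Y \<phi> w"
  shows "right_closing_ae X \<phi>"
proof -
  obtain k :: nat where k: "\<And>x y i j l. x \<in> X \<Longrightarrow> y \<in> X \<Longrightarrow> occurs_at w (\<phi> x) i \<Longrightarrow>
      (\<And>l. i \<le> l \<Longrightarrow> l \<le> j + int k \<Longrightarrow> \<phi> x l = \<phi> y l) \<Longrightarrow>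
      i + int (length w) \<le> l \<Longrightarrow> l \<le> j \<Longrightarrow> x l = y l"
    using decoder_block_decodes[OF X cr w] by blast
  show ?thesis
    unfolding right_closing_ae_def
  proof (intro exI[of _ "k + 1"] allI impI)
    fix x y
    assume lt: "left_transitive X x" "left_transitive X y"
      and agree: "\<forall>i\<le>int (k + 1). \<phi> x i = \<phi> y i"
    have xy: "x \<in> X" "y \<in> X" using lt by (auto simp: left_transitive_iff)
    have "w \<in> language (\<phi> ` X)" using w Y by (simp add: decoder_block_def)
    then obtain i where i: "i \<le> - int (length w)" "occurs_at w (\<phi> x) i"
      using left_transitive_image[OF cr lt(1)] unfolding left_transitive_iff by blast
    show "x 1 = y 1"
      by (rule k[OF xy i(2), of 1]) (use agree i(1) in auto)
  qed
qed

lemma decoder_block_imp_one_to_one_ae: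
  assumes X: "subshift A X" and cr: "coding_radius X \<phi> M" and Y: "\<phi> ` X = Y"
    and w: "decoder_block X Y \<phi> w"
  shows "one_to_one_ae X Y \<phi>"
  unfolding one_to_one_ae_def
proof (intro allI impI)
  obtain k :: nat where k: "\<And>x y i j l. x \<in> X \<Longrightarrow> y \<in> X \<Longrightarrow> occurs_at w (\<phi> x) i \<Longrightarrow>
      (\<And>l. i \<le> l \<Longrightarrow> l \<le> j + int k \<Longrightarrow> \<phi> x l = \<phi> y l) \<Longrightarrow>
      i + int (length w) \<le> l \<Longrightarrow> l \<le> j \<Longrightarrow> x l = y l"
    using decoder_block_decodes[OF X cr w] by blast
  fix y assume "doubly_transitive Y y"
  then have lt: "left_transitive Y y" by (simp add: doubly_transitive_iff)
  have wY: "w \<in> language Y" using w by (simp add: decoder_block_def)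
  obtain x where x: "x \<in> X" "\<phi> x = y" using lt Y by (auto simp: left_transitive_iff)
  have "x' = x" if x': "x' \<in> X" "\<phi> x' = y" for x'
  proof
    fix l
    obtain i where i: "i \<le> l - int (length w)" "occurs_at w y i"
      using lt wY unfolding left_transitive_iff by blast
    show "x' l = x l"
      by (rule k[OF x'(1) x(1), of i l]) (use i x x' in auto)
  qed
  then show "\<exists>!x. x \<in> X \<and> \<phi> x = y" using x by blast
qed

section \<open>From the two properties to a decoder block\<close>

text \<open>Left-transitivity is invariant under translation, so the one-step determination of the
  definition can be repeated.\<close>

lemma right_closing_ae_iterate:
  assumes X: "subshift A X" and cr: "coding_radius X \<phi> M" and "right_closing_ae X \<phi>"
  obtains K :: nat where "\<And>x y (n::nat) i. left_transitive X x \<Longrightarrow> left_transitive X y \<Longrightarrow>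
      (\<And>i. i \<le> 0 \<Longrightarrow> x i = y i) \<Longrightarrow> (\<And>i. i \<le> int (n + K) \<Longrightarrow> \<phi> x i = \<phi> y i) \<Longrightarrow>
      i \<le> int n \<Longrightarrow> x i = y i"
proof -
  obtain K :: nat where K: "\<And>x y. left_transitive X x \<Longrightarrow> left_transitive X y \<Longrightarrow>
      (\<forall>i\<le>0. x i = y i) \<Longrightarrow> (\<forall>i\<le>int K. \<phi> x i = \<phi> y i) \<Longrightarrow> x 1 = y 1"
    using assms(3) unfolding right_closing_ae_def by blast
  have "x i = y i"
    if lt: "left_transitive X x" "left_transitive X y" and "\<And>i. i \<le> 0 \<Longrightarrow> x i = y i"
      and "\<And>i. i \<le> int (n + K) \<Longrightarrow> \<phi> x i = \<phi> y i" "i \<le> int n" for x y n i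
    using that(3-)
  proof (induction n arbitrary: i)
    case 0
    then show ?case by simp
  next
    case (Suc n)
    have le: "x l = y l" if "l \<le> int n" for l
      using Suc.IH[of l] Suc.prems that by simp
    have xy: "x \<in> X" "y \<in> X" using lt by (auto simp: left_transitive_iff)
    have "x (1 + int n) = y (1 + int n)"
    proof (rule K[of "\<lambda>l. x (l + int n)" "\<lambda>l. y (l + int n)"])
      show "left_transitive X (\<lambda>l. x (l + int n))" "left_transitive X (\<lambda>l. y (l + int n))"
        using left_transitive_translate[OF X] lt by auto
      show "\<forall>l\<le>0. x (l + int n) = y (l + int n)" using le by simp
      show "\<forall>l\<le>int K. \<phi> (\<lambda>l. x (l + int n)) l = \<phi> (\<lambda>l. y (l + int n)) l"
        using Suc.prems(2) by (simp add: coding_radius_translate[OF X cr] xy)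
    qed
    moreover have "i \<le> int n \<or> i = 1 + int n" using Suc.prems(3) by auto
    ultimately show ?case using le by metis
  qed
  then show thesis using that by blast
qed

text \<open>Two points that agree with \<open>z\<close> on \<open>[-2M, 0]\<close> may be given the past of \<open>z\<close> without disturbing
  the comparison of their images: coordinates up to \<open>-M\<close> of the new images see only the past of \<open>z\<close>,
  those beyond \<open>-M\<close> see only coordinates beyond \<open>-2M\<close>, where the points are unchanged.\<close>

lemma splice_images_agree:
  assumes cr: "coding_radius X \<phi> M"
    and X: "z \<in> X" "x \<in> X" "y \<in> X" "splice z x \<in> X" "splice z y \<in> X"
    and x: "\<And>i. - 2 * int M \<le> i \<Longrightarrow> i \<le> 0 \<Longrightarrow> x i = z i"
    and y: "\<And>i. - 2 * int M \<le> i \<Longrightarrow> i \<le> 0 \<Longrightarrow> y i = z i"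
    and agree: "- int M < i \<Longrightarrow> \<phi> x i = \<phi> y i"
  shows "\<phi> (splice z x) i = \<phi> (splice z y) i"
proof (cases "- int M < i")
  case True
  have "\<phi> (splice z x) i = \<phi> x i"
    using True x by (intro coding_radiusD[OF cr X(4,2)]) (auto simp: splice_def)
  moreover have "\<phi> (splice z y) i = \<phi> y i"
    using True y by (intro coding_radiusD[OF cr X(5,3)]) (auto simp: splice_def)
  ultimately show ?thesis using agree True by simp
next
  case False
  then show ?thesis
    by (intro coding_radiusD[OF cr X(4,5)]) (auto simp: splice_def)
qed

lemma exists_decoder_block:
  assumes X: "subshift A X" and hs: "half_synchronized X"
    and cr: "coding_radius X \<phi> M" and Y: "\<phi> ` X = Y"
    and rc: "right_closing_ae X \<phi>" and oo: "one_to_one_ae X Y \<phi>"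
  shows "\<exists>w. decoder_block X Y \<phi> w"
proof -
  obtain z L where z: "doubly_transitive X z"
    and spl: "\<And>x. x \<in> X \<Longrightarrow> (\<And>i. - int L < i \<Longrightarrow> i \<le> 0 \<Longrightarrow> x i = z i) \<Longrightarrow> splice z x \<in> X"
    using half_synchronized_splice[OF X hs] by blast
  have lt: "left_transitive X z" using z by (simp add: doubly_transitive_iff)
  then have zX: "z \<in> X" by (simp add: left_transitive_iff)
  have "doubly_transitive Y (\<phi> z)" using doubly_transitive_image[OF cr z] Y by simp
  then have unique: "\<And>x. x \<in> X \<Longrightarrow> \<phi> x = \<phi> z \<Longrightarrow> x = z"
    using oo zX unfolding one_to_one_ae_def by blast
  obtain K :: nat where K: "\<And>x y (n::nat) i. left_transitive X x \<Longrightarrow> left_transitive X y \<Longrightarrow>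
      (\<And>i. i \<le> 0 \<Longrightarrow> x i = y i) \<Longrightarrow> (\<And>i. i \<le> int (n + K) \<Longrightarrow> \<phi> x i = \<phi> y i) \<Longrightarrow>
      i \<le> int n \<Longrightarrow> x i = y i"
    using right_closing_ae_iterate[OF X cr rc] by blast
  obtain N0 :: nat where N0: "\<And>x i. x \<in> X \<Longrightarrow> (\<And>l. \<bar>l\<bar> \<le> int N0 \<Longrightarrow> \<phi> x l = \<phi> z l)
      \<Longrightarrow> \<bar>i\<bar> \<le> int (L + 2 * M) \<Longrightarrow> x i = z i"
    using unique_preimage_window[OF X cr unique, of "L + 2 * M"] by blast
  \<comment> \<open>The block has to cover \<open>[-M, 0]\<close> as well, where the image depends on both halves.\<close>
  define N where "N = N0 + M"
  define w where "w = block (\<phi> z) (- int N) (int N)"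
  have lw: "length w = 2 * N + 1" by (simp add: w_def)
  have decode: "x i = y i"
    if x: "x \<in> X" "\<And>l. \<bar>l\<bar> \<le> int N \<Longrightarrow> \<phi> x l = \<phi> z l"
      and y: "y \<in> X" "\<And>l. \<bar>l\<bar> \<le> int N \<Longrightarrow> \<phi> y l = \<phi> z l"
      and agree: "\<And>l. int N < l \<Longrightarrow> l \<le> int (n + K) \<Longrightarrow> \<phi> x l = \<phi> y l"
      and i: "0 < i" "i \<le> int n" for x y n i
  proof -
    have xz: "x l = z l" and yz: "y l = z l" if "\<bar>l\<bar> \<le> int (L + 2 * M)" for l
      using N0[OF x(1) x(2) that] N0[OF y(1) y(2) that] by (simp_all add: N_def)
    have sx: "splice z x \<in> X" using xz by (intro spl[OF x(1)]) auto
    have sy: "splice z y \<in> X" using yz by (intro spl[OF y(1)]) auto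
    have "splice z x i = splice z y i"
    proof (rule K[of _ _ n])
      show "left_transitive X (splice z x)"
        by (rule left_transitive_cong[OF lt sx]) (simp add: splice_def)
      show "left_transitive X (splice z y)"
        by (rule left_transitive_cong[OF lt sy]) (simp add: splice_def)
      show "splice z x l = splice z y l" if "l \<le> 0" for l
        using that by (simp add: splice_def)
      show "\<phi> (splice z x) l = \<phi> (splice z y) l" if l: "l \<le> int (n + K)" for l
      proof (rule splice_images_agree[OF cr zX x(1) y(1) sx sy])
        show "\<phi> x l = \<phi> y l" if "- int M < l"
        proof (cases "l \<le> int N")
          case True
          then show ?thesis using x(2)[of l] y(2)[of l] that by (simp add: N_def)
        next
          case False
          then show ?thesis using agree l by simp
        qed
      qed (use xz yz in auto)
    qed (fact i(2))
    then show ?thesis using i(1) by (simp add: splice_def)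
  qed
  have "decoder_block X Y \<phi> w"
    unfolding decoder_block_def
  proof (intro conjI exI[of _ K] allI ballI impI)
    show "w \<in> language Y"
      unfolding w_def using zX Y by (intro block_in_language) blast
    fix n x y
    assume x: "x \<in> X" and y: "y \<in> X"
      and wx: "block (\<phi> x) (- int (length w) + 1) 0 = w"
      and wy: "block (\<phi> y) (- int (length w) + 1) 0 = w"
      and agree: "block (\<phi> x) 1 (int (n + K)) = block (\<phi> y) 1 (int (n + K))"
    \<comment> \<open>Move the occurrence of \<open>w\<close> to the centre, where it sits in \<open>\<phi> z\<close>.\<close>
    have centre: "\<phi> (\<lambda>t. p (t - int N)) l = \<phi> z l"
      if p: "p \<in> X" and wp: "block (\<phi> p) (- int (length w) + 1) 0 = w" and l: "\<bar>l\<bar> \<le> int N"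
      for p l
    proof -
      have occ: "occurs_at w (\<phi> p) (- int (length w) + 1)"
        using wp by (simp add: block_eq_iff_occurs_at)
      define k where "k = nat (l + int N)"
      have k: "l = int k - int N" "k < length w" using l by (auto simp: k_def lw)
      have "\<phi> (\<lambda>t. p (t - int N)) l = \<phi> p (l - int N)"
        using coding_radius_translate[OF X cr p, of "- int N"] by simp
      also have "\<dots> = \<phi> p (- int (length w) + 1 + int k)" by (simp add: k lw)
      also have "\<dots> = w ! k" using occ k by (simp add: occurs_at_def)
      also have "\<dots> = \<phi> z (- int N + int k)"
        unfolding w_def using k by (intro nth_block) (simp add: lw)
      also have "\<dots> = \<phi> z l" by (simp add: k)
      finally show ?thesis .
    qed
    have in_X: "(\<lambda>t. p (t - int N)) \<in> X" if "p \<in> X" for p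
      using subshift_translate[OF X that, of "- int N"] by simp
    have right: "\<phi> (\<lambda>t. x (t - int N)) l = \<phi> (\<lambda>t. y (t - int N)) l"
      if "int N < l" "l \<le> int (n + N + K)" for l
      using agree that coding_radius_translate[OF X cr x, of "- int N"]
        coding_radius_translate[OF X cr y, of "- int N"]
      by (simp add: block_eq_block_iff)
    show "block x 1 (int n) = block y 1 (int n)"
      unfolding block_eq_block_iff
    proof (intro allI impI)
      fix l assume l: "1 \<le> l \<and> l \<le> int n"
      have "x (l + int N - int N) = y (l + int N - int N)"
        by (rule decode[where n = "n + N", OF in_X[OF x] centre[OF x wx] in_X[OF y] centre[OF y wy] right])
          (use l in auto)
      then show "x l = y l" by simp
    qed
  qed
  then show ?thesis by blast
qed

theorem theorem4p2:
  fixes A :: "'a set" and D :: "'b set"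
    and X :: "'a biseq set" and Y :: "'b biseq set"
    and \<phi> :: "'a biseq \<Rightarrow> 'b biseq"
  assumes "subshift A X" and "half_synchronized X"
    and "subshift D Y" and "factor_map X Y \<phi>"
  shows "right_closing_ae X \<phi> \<and> one_to_one_ae X Y \<phi> \<longleftrightarrow> (\<exists>w. decoder_block X Y \<phi> w)"
proof -
  have Y: "\<phi> ` X = Y" using assms(4) by (simp add: factor_map_def)
  obtain M where cr: "coding_radius X \<phi> M" using factor_map_coding_radius[OF assms(4)] .
  show ?thesis
    using exists_decoder_block[OF assms(1,2) cr Y]
      decoder_block_imp_right_closing_ae[OF assms(1) cr Y]
      decoder_block_imp_one_to_one_ae[OF assms(1) cr Y]
    by blast
qed

end
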